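(* For all sufficiently large integers $k$ there exists a measurable function $f:[0,1]^k\to\{0,1\}$ such that, if $\{U_i\}_{i\in\mathbb{N}}$ is a sequence of i.i.d. random variables uniformly distributed on $[0,1]$ and $Z^f_i=f(U_i,\dots,U_{i+k-1})$ for $i\ge 1$, then $$\mathbb{P}(Z^f_1=Z^f_2=\dots=Z^f_{2k})<\frac{9k^2}{M},$$ where $M=T_{k-2}(k/\sqrt{8})$ is the tower consisting of $k-2$ twos topped by the exponent $k/\sqrt{8}$.
   Context: $\mathbb{N}=\{1,2,3,\dots\}$. For real $x$, the tower $T_j(x)$ is defined by $T_0(x)=x$ and $T_{j}(x)=2^{T_{j-1}(x)}$ for $j\ge1$; thus $T_{k-2}(x)=2^{2^{\cdot^{\cdot^{2^{x}}}}}$ with exactly $k-2$ twos. The process $Z^f_i=f(U_i,\dots,U_{i+k-1})$ is called a $k$-block factor. *)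

theory Defs
  imports "HOL-Probability.Probability"
begin

primrec tower :: "nat \<Rightarrow> real \<Rightarrow> real" where
  "tower 0 x = x"
| "tower (Suc j) x = 2 powr tower j x"

abbreviation unit_borel :: "real measure" where
  "unit_borel \<equiv> restrict_space borel {0..1}"

text \<open>The variables are indexed by \<open>i \<ge> 1\<close>; \<open>U 0\<close> is unconstrained. Using \<open>unit_borel\<close> as
  the target makes every \<open>U i\<close> take values in \<open>[0,1]\<close> surely, so that functions with
  domain \<open>[0,1]^k\<close> may be applied to them.\<close>

definition iid_uniform :: "'a measure \<Rightarrow> (nat \<Rightarrow> 'a \<Rightarrow> real) \<Rightarrow> bool" where
  "iid_uniform M U \<longleftrightarrow>
     prob_space M \<and>
     prob_space.indep_vars M (\<lambda>_. unit_borel) U {1..} \<and>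
     (\<forall>i\<ge>1. distr M lborel (U i) = uniform_measure lborel {0..1})"

text \<open>A point of \<open>[0,1]^k\<close> is an extensional function on \<open>{..<k}\<close>, as in the product
  measure space; coordinates are therefore numbered from \<open>0\<close>.\<close>

definition block_factor ::
    "nat \<Rightarrow> ((nat \<Rightarrow> real) \<Rightarrow> nat) \<Rightarrow> (nat \<Rightarrow> 'a \<Rightarrow> real) \<Rightarrow> nat \<Rightarrow> 'a \<Rightarrow> nat" where
  "block_factor k f U i \<omega> = f (\<lambda>j\<in>{..<k}. U (i + j) \<omega>)"


text \<open>The law of an i.i.d. uniform sequence is unique, and such a sequence exists on the type
  \<open>nat \<Rightarrow> real\<close>. Hence a bound on the probability of a block factor event, for a given \<open>f\<close>, that
  holds for all i.i.d. uniform sequences on spaces over \<open>nat \<Rightarrow> real\<close> holds for the same \<open>f\<close>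
  over every type of sample points.\<close>

abbreviation unif :: "real measure" where
  "unif \<equiv> restrict_space (uniform_measure lborel {0..1}) {0..1}"

lemma prob_space_unif: "prob_space unif"
  by (rule prob_space_restrict_space) (auto simp: emeasure_uniform_measure)

lemma sets_unif: "sets unif = sets unit_borel"
  by (auto simp: sets_restrict_space)

lemma sets_PiM_unif: "sets (PiM I (\<lambda>_. unif)) = sets (PiM I (\<lambda>_. unit_borel))"
  by (rule sets_PiM_cong) (auto simp: sets_unif)

lemma iid_uniform_law:
  assumes "iid_uniform M U"
  shows "distr M (PiM {1..} (\<lambda>_. unit_borel)) (\<lambda>\<omega>. \<lambda>i\<in>{1..}. U i \<omega>) = PiM {1..} (\<lambda>_. unif)"
proof -
  interpret prob_space M using assms by (simp add: iid_uniform_def)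
  have ind: "indep_vars (\<lambda>_. unit_borel) U {1..}"
    and d: "\<And>i. i \<ge> 1 \<Longrightarrow> distr M lborel (U i) = uniform_measure lborel {0..1}"
    using assms by (auto simp: iid_uniform_def)
  have rv: "random_variable unit_borel (U i)" if "i \<in> {1..}" for i
    using ind that by (auto simp: indep_vars_def)
  have "distr M unit_borel (U i) = unif" if "i \<in> {1..}" for i
  proof -
    have m: "U i \<in> measurable M borel" "U i \<in> space M \<rightarrow> {0..1}"
      using rv[OF that] by (auto simp: measurable_restrict_space2_iff)
    have m': "U i \<in> measurable M lborel" using m(1) by simp
    have "unif = restrict_space (distr M lborel (U i)) {0..1}"
      using d that by simp
    also have "\<dots> = distr M (restrict_space lborel {0..1}) (U i)"
      by (rule restrict_distr[OF m' _ m(2)]) simp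
    also have "\<dots> = distr M unit_borel (U i)"
      by (rule distr_cong) (auto simp: sets_restrict_space)
    finally show ?thesis by simp
  qed
  then have "PiM {1..} (\<lambda>i. distr M unit_borel (U i)) = PiM {1..} (\<lambda>_. unif)"
    by (intro PiM_cong) auto
  moreover have "distr M (PiM {1..} (\<lambda>_. unit_borel)) (\<lambda>\<omega>. \<lambda>i\<in>{1..}. U i \<omega>)
      = PiM {1..} (\<lambda>i. distr M unit_borel (U i))"
    using indep_vars_iff_distr_eq_PiM'[of "{1..}" U "\<lambda>_. unit_borel"] rv ind by auto
  ultimately show ?thesis by simp
qed

lemma block_factor_event_law:
  assumes "iid_uniform M U"
    and f: "f \<in> measurable (\<Pi>\<^sub>M j\<in>{..<k}. unit_borel) (count_space {0, 1 :: nat})"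
  shows "measure M {\<omega> \<in> space M. \<forall>i\<in>{1..n}. block_factor k f U i \<omega> = block_factor k f U 1 \<omega>} =
    measure (PiM {1..} (\<lambda>_. unif))
      {\<omega> \<in> space (PiM {1..} (\<lambda>_. unif)).
        \<forall>i\<in>{1..n}. block_factor k f (\<lambda>i \<omega>. \<omega> i) i \<omega> = block_factor k f (\<lambda>i \<omega>. \<omega> i) 1 \<omega>}"
    (is "_ = measure _ ?E")
proof -
  let ?V = "\<lambda>i (\<omega> :: nat \<Rightarrow> real). \<omega> i" and ?P = "PiM {1::nat..} (\<lambda>_. unit_borel)"
  let ?X = "\<lambda>\<omega>. \<lambda>i\<in>{1..}. U i \<omega>"
  have sp: "space (PiM {1::nat..} (\<lambda>_. unif)) = space ?P"
    using sets_eq_imp_space_eq[OF sets_PiM_unif] .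
  have win: "(\<lambda>\<omega>. \<lambda>j\<in>{..<k}. \<omega> (i + j)) \<in> measurable ?P (\<Pi>\<^sub>M j\<in>{..<k}. unit_borel)"
    if "i \<ge> 1" for i
    using that by (intro measurable_restrict measurable_component_singleton) auto
  have bf: "block_factor k f ?V i \<in> measurable ?P (count_space {0, 1})" if "i \<ge> 1" for i
    using measurable_compose[OF win[OF that] f] by (simp add: block_factor_def[abs_def])
  have "{\<omega> \<in> space ?P. block_factor k f ?V i \<omega> = block_factor k f ?V 1 \<omega>} \<in> sets ?P"
    if "i \<ge> 1" for i
  proof -
    have eq: "{\<omega> \<in> space ?P. block_factor k f ?V i \<omega> = block_factor k f ?V 1 \<omega>} =
      (\<Union>b\<in>{0, 1}. (block_factor k f ?V i -` {b} \<inter> space ?P)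
         \<inter> (block_factor k f ?V 1 -` {b} \<inter> space ?P))"
      using measurable_space[OF bf[OF that]] by fastforce
    show ?thesis
      unfolding eq
      by (intro sets.finite_UN sets.Int measurable_sets[OF bf[OF that]] measurable_sets[OF bf]) auto
  qed
  then have E: "?E \<in> sets ?P"
    unfolding sp by (intro sets.sets_Collect_finite_All) auto
  have rv: "U i \<in> measurable M unit_borel" if "i \<in> {1..}" for i
    using assms(1) that
    by (auto simp: iid_uniform_def prob_space.indep_vars_def)
  have X: "?X \<in> measurable M ?P"
    by (intro measurable_restrict rv)
  have ev: "block_factor k f ?V i (?X \<omega>) = block_factor k f U i \<omega>" if "i \<ge> 1" for i \<omega>
  proof -
    have "(\<lambda>j\<in>{..<k}. ?X \<omega> (i + j)) = (\<lambda>j\<in>{..<k}. U (i + j) \<omega>)"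
      using that by (intro restrict_ext) auto
    then show ?thesis unfolding block_factor_def by (rule arg_cong)
  qed
  have "?X -` ?E \<inter> space M =
    {\<omega> \<in> space M. \<forall>i\<in>{1..n}. block_factor k f U i \<omega> = block_factor k f U 1 \<omega>}"
    using measurable_space[OF X] ev unfolding sp by auto
  then show ?thesis
    using measure_distr[OF X E] unfolding iid_uniform_law[OF assms(1)] by simp
qed

lemma iid_uniform_canonical: "iid_uniform (\<Pi>\<^sub>M i\<in>{1..}. unif) (\<lambda>i \<omega>. \<omega> i)"
proof -
  interpret U: prob_space unif by (rule prob_space_unif)
  interpret P: product_prob_space "\<lambda>_. unif" "{1::nat..}" by unfold_locales
  let ?P = "PiM {1::nat..} (\<lambda>_. unif)"
  have m: "(\<lambda>\<omega>. \<omega> i) \<in> measurable ?P unif" if "i \<in> {1..}" for i :: nat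
    using that by (rule measurable_component_singleton)
  have m': "(\<lambda>\<omega>. \<omega> i) \<in> measurable ?P unit_borel" if "i \<in> {1..}" for i :: nat
    using m[OF that] measurable_cong_sets[OF refl sets_unif] by auto
  have c: "distr ?P unif (\<lambda>\<omega>. \<omega> i) = unif" if "i \<in> {1..}" for i :: nat
    using that by (rule P.PiM_component)
  have c': "distr ?P unit_borel (\<lambda>\<omega>. \<omega> i) = unif" if "i \<in> {1..}" for i :: nat
    using c[OF that] distr_cong[OF refl sets_unif[symmetric] refl] by metis
  have "distr ?P (PiM {1..} (\<lambda>_. unit_borel)) (\<lambda>\<omega>. \<lambda>i\<in>{1..}. \<omega> i) = distr ?P ?P (\<lambda>\<omega>. \<omega>)"
    by (rule distr_cong) (auto simp: sets_PiM_unif[symmetric] space_PiM PiE_restrict)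
  also have "\<dots> = ?P" by (rule distr_id2) simp
  also have "\<dots> = PiM {1..} (\<lambda>i. distr ?P unit_borel (\<lambda>\<omega>. \<omega> i))"
    by (rule PiM_cong) (simp_all only: c')
  finally have "P.indep_vars (\<lambda>_. unit_borel) (\<lambda>i \<omega>. \<omega> i) {1..}"
    using P.indep_vars_iff_distr_eq_PiM'[of "{1::nat..}" "\<lambda>i \<omega>. \<omega> i" "\<lambda>_. unit_borel"] m' by auto
  moreover have "distr ?P lborel (\<lambda>\<omega>. \<omega> i) = uniform_measure lborel {0..1}" if "i \<ge> 1" for i :: nat
  proof -
    have u: "(\<lambda>x. x) \<in> measurable unif lborel"
      by (auto intro!: measurableI simp: sets_restrict_space space_restrict_space)
    have "distr ?P lborel (\<lambda>\<omega>. \<omega> i) = distr (distr ?P unif (\<lambda>\<omega>. \<omega> i)) lborel (\<lambda>x. x)"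
      using distr_distr[OF u m[of i]] that by (simp add: comp_def)
    also have "\<dots> = distr unif lborel (\<lambda>x. x)" using c that by simp
    also have "\<dots> = uniform_measure lborel {0..1}"
    proof (rule measure_eqI)
      fix A assume "A \<in> sets (distr unif lborel (\<lambda>x. x))"
      then have A: "A \<in> sets borel" by simp
      have "emeasure (distr unif lborel (\<lambda>x. x)) A = emeasure unif (A \<inter> {0..1})"
        using A u by (simp add: emeasure_distr space_restrict_space)
      also have "\<dots> = emeasure (uniform_measure lborel {0..1}) A"
        using A by (simp add: emeasure_restrict_space emeasure_uniform_measure Int_commute Int_left_commute)
      finally show "emeasure (distr unif lborel (\<lambda>x. x)) A = emeasure (uniform_measure lborel {0..1}) A" .
    qed simp
    finally show ?thesis .
  qed
  ultimately show ?thesis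
    using P.prob_space_axioms by (simp add: iid_uniform_def)
qed

corollary block_factor_event_unique:
  assumes "iid_uniform M U" "iid_uniform N V"
    and "f \<in> measurable (\<Pi>\<^sub>M j\<in>{..<k}. unit_borel) (count_space {0, 1 :: nat})"
  shows "measure M {\<omega> \<in> space M. \<forall>i\<in>{1..n}. block_factor k f U i \<omega> = block_factor k f U 1 \<omega>} =
    measure N {\<omega> \<in> space N. \<forall>i\<in>{1..n}. block_factor k f V i \<omega> = block_factor k f V 1 \<omega>}"
  using block_factor_event_law[OF assms(1,3)] block_factor_event_law[OF assms(2,3)] by simp

end

theory Submission
  imports Defs
begin

text \<open>Call a word proper if its consecutive letters differ. Recording, for two distinct letters
  below \<open>2 ^ n\<close>, the first binary digit in which they differ together with the value of this
  digit in the first of them turns a proper word over \<open>2 ^ n\<close> letters into a proper word over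
  \<open>2 * n\<close> letters: if the same position is recorded twice in a row, then the recorded values differ.
  Each letter of the new word depends on two letters of the old one, so \<open>k - 2\<close> iterations followed
  by the comparison of two adjacent letters are a function of \<open>k\<close> letters. Starting from a number
  \<open>N\<close> of letters that is a tower of height \<open>k - 2\<close>, one arrives at \<open>2 * k\<close> letters, and if all of
  \<open>2 * k\<close> adjacent comparisons agree, one gets a strictly monotone word of length \<open>2 * k + 1\<close>, which is
  impossible. Splitting \<open>[0,1]\<close> into \<open>N\<close> equal cells, the word of the cells visited by the
  \<open>U\<^sub>i\<close> is proper up to probability less than \<open>3 * k / N\<close>.\<close>

section \<open>Recoding words by first differing binary digits\<close>

definition arc :: "nat \<Rightarrow> nat \<Rightarrow> nat" where
  "arc x y = (let d = LEAST d. bit x d \<noteq> bit y d in 2 * d + of_bool (bit x d))"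

definition arcs :: "(nat \<Rightarrow> nat) \<Rightarrow> nat \<Rightarrow> nat" where
  "arcs w i = arc (w i) (w (Suc i))"

lemma bit_Least_differ:
  assumes "(x::nat) \<noteq> y"
  shows "bit x (LEAST d. bit x d \<noteq> bit y d) \<noteq> bit y (LEAST d. bit x d \<noteq> bit y d)"
proof -
  from assms obtain d where "bit x d \<noteq> bit y d" by (auto simp: bit_eq_iff)
  then show ?thesis by (rule LeastI)
qed

lemma arc_less:
  assumes "x \<noteq> y" "x < 2 ^ n" "y < 2 ^ n"
  shows "arc x y < 2 * n"
proof -
  let ?d = "LEAST d. bit x d \<noteq> bit y d"
  have "?d < n"
  proof (rule ccontr)
    assume "\<not> ?d < n"
    then have "(2::nat) ^ n \<le> 2 ^ ?d" by simp
    with assms have "x < 2 ^ ?d" "y < 2 ^ ?d" by linarith+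
    \<comment> \<open>Position \<open>?d\<close> lies beyond the binary length of both numbers, so
      both digits are 0.\<close>
    then have "\<not> bit x ?d" "\<not> bit y ?d" by (simp_all add: bit_iff_odd)
    with bit_Least_differ[OF assms(1)] show False by simp
  qed
  then show ?thesis by (auto simp: arc_def Let_def)
qed

lemma arc_neq:
  assumes "x \<noteq> y" "y \<noteq> z"
  shows "arc x y \<noteq> arc y z"
proof
  let ?d = "LEAST d. bit x d \<noteq> bit y d" and ?e = "LEAST d. bit y d \<noteq> bit z d"
  assume "arc x y = arc y z"
  then have eq: "2 * ?d + of_bool (bit x ?d) = 2 * ?e + of_bool (bit y ?e)"
    by (simp add: arc_def Let_def)
  \<comment> \<open>Halves of the codes are positions, parities are digits. Equal codes would make
    \<open>x\<close> and \<open>y\<close> agree at the first digit in which they differ.\<close>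
  then have "?d = ?e"
    by (auto simp: of_bool_def split: if_splits)
  then have "bit x ?d = bit y ?d" using eq by (auto simp: of_bool_def split: if_splits)
  with bit_Least_differ[OF assms(1)] show False by simp
qed

text \<open>Each iteration looks one letter further right, so \<open>n\<close> of them see
  \<open>n + 1\<close> letters. Separate offsets allow a window to be matched with its place in a
  longer word.\<close>

lemma arcs_iterate_cong:
  assumes "\<And>j. j \<le> n \<Longrightarrow> v (i + j) = w (m + j)"
  shows "(arcs ^^ n) v i = (arcs ^^ n) w m"
  using assms
proof (induction n arbitrary: i m)
  case (Suc n)
  have "(arcs ^^ n) v i = (arcs ^^ n) w m"
    by (rule Suc.IH) (use Suc.prems in auto)
  moreover have "(arcs ^^ n) v (Suc i) = (arcs ^^ n) w (Suc m)"
  proof (rule Suc.IH)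
    fix j assume "j \<le> n"
    then show "v (Suc i + j) = w (Suc m + j)" using Suc.prems[of "Suc j"] by simp
  qed
  ultimately show ?case by (simp add: arcs_def[of "(arcs ^^ n) _"])
qed (use assms[of 0] in simp)

text \<open>\<open>L\<close> counts adjacent pairs: the word has \<open>L + 1\<close>
  letters.\<close>

definition proper :: "nat \<Rightarrow> nat \<Rightarrow> (nat \<Rightarrow> nat) \<Rightarrow> bool" where
  "proper N L w \<longleftrightarrow> (\<forall>i\<le>L. w i < N) \<and> (\<forall>i<L. w i \<noteq> w (Suc i))"

lemma proper_arcs:
  assumes "proper (2 ^ n) (Suc L) w"
  shows "proper (2 * n) L (arcs w)"
  using assms arc_neq by (simp add: proper_def arcs_def arc_less)

section \<open>Alphabet sizes and the tower\<close>

text \<open>Half the number of letters needed for \<open>j\<close> iterations to end with \<open>2 * k\<close> letters.\<close>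

primrec half_letters :: "nat \<Rightarrow> nat \<Rightarrow> nat" where
  "half_letters k 0 = k"
| "half_letters k (Suc j) = 2 ^ (half_letters k j - 1)"

lemma half_letters_pos: "k > 0 \<Longrightarrow> half_letters k j > 0"
  by (cases j) auto

lemma proper_arcs_iterate:
  assumes "k > 0" "proper (2 * half_letters k j) (L + j) w"
  shows "proper (2 * k) L ((arcs ^^ j) w)"
  using assms(2)
proof (induction j arbitrary: w)
  case (Suc j)
  \<comment> \<open>The \<open>- 1\<close> in the exponent absorbs the factor 2, so the alphabet
    size is the exact power of two that \<open>proper_arcs\<close> asks for.\<close>
  have "2 * half_letters k (Suc j) = 2 ^ half_letters k j"
    using half_letters_pos[OF assms(1), of j] by (cases "half_letters k j") auto
  with Suc.prems have "proper (2 * half_letters k j) (L + j) (arcs w)"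
    by (auto intro: proper_arcs)
  then show ?case using Suc.IH by (simp add: funpow_swap1)
qed simp

lemma tower_ge: "x \<ge> 2 \<Longrightarrow> tower j x \<ge> 2"
proof (induction j)
  case (Suc j)
  then have "2 powr 1 \<le> 2 powr tower j x" by (intro powr_mono) auto
  then show ?case by simp
qed simp

text \<open>The surplus 2 carries the induction: one unit pays for the \<open>- 1\<close> in the
  exponent, the other doubles the power, and doubling a tower that is at least 2 restores the
  surplus.\<close>

lemma half_letters_ge_tower:
  assumes "x \<ge> 2" "real k \<ge> x + 2"
  shows "real (half_letters k j) \<ge> tower j x + 2"
proof (induction j)
  case (Suc j)
  have pos: "half_letters k j \<ge> 1" using half_letters_pos[of k j] assms by (auto simp: Suc_le_eq)
  have "2 * tower (Suc j) x = 2 powr (tower j x + 1)" by (simp add: powr_add)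
  also have "\<dots> \<le> 2 powr real (half_letters k j - 1)"
    using Suc pos by (intro powr_mono) (auto simp: of_nat_diff)
  also have "\<dots> = real (half_letters k (Suc j))" by (simp add: powr_realpow)
  finally show ?case using tower_ge[OF assms(1), of "Suc j"] by simp
qed (use assms in simp)

section \<open>Monotone words over small alphabets\<close>

lemma strict_mono_word_long:
  fixes w :: "nat \<Rightarrow> nat"
  assumes "\<And>i. i < n \<Longrightarrow> w i < w (Suc i)"
  shows "w n \<ge> w 0 + n"
  using assms
proof (induction n)
  case (Suc n)
  then show ?case by (metis add_Suc_right le_SucI Suc_leI less_SucI lessI order.strict_trans1)
qed simp

text \<open>After \<open>n\<close> strict increases a value is at least \<open>n\<close>, outside
  the alphabet. If \<open>b\<close> is false, properness makes every step a strict decrease, and the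
  word is read backwards.\<close>

lemma proper_not_monotone:
  assumes "proper n n w"
  shows "\<not> (\<forall>i<n. (w i < w (Suc i)) = b)"
proof
  assume *: "\<forall>i<n. (w i < w (Suc i)) = b"
  show False
  proof (cases b)
    case True
    with * strict_mono_word_long[of n w] assms show False by (auto simp: proper_def)
  next
    case False
    have "w (n - i) < w (n - Suc i)" if "i < n" for i
    proof -
      have "Suc (n - Suc i) = n - i" using that by simp
      with * False assms that show ?thesis
        by (metis proper_def diff_less linorder_neqE_nat order.strict_trans1 zero_less_Suc le0)
    qed
    with strict_mono_word_long[of n "\<lambda>i. w (n - i)"] assms show False by (auto simp: proper_def)
  qed
qed

section \<open>Cells of the unit interval and the block factor\<close>

text \<open>The cells are \<open>[0, 1/N], (1/N, 2/N], \<dots>\<close>; the truncated subtraction puts \<open>0\<close> into the first one.\<close>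

definition cell :: "nat \<Rightarrow> real \<Rightarrow> nat" where
  "cell N u = nat \<lceil>real N * u\<rceil> - 1"

lemma cell_less: "N > 0 \<Longrightarrow> u \<le> 1 \<Longrightarrow> cell N u < N"
proof -
  assume "N > 0" "u \<le> 1"
  then have "real N * u \<le> real_of_int (int N)" by (simp add: mult_left_le)
  then have "\<lceil>real N * u\<rceil> \<le> int N" by (simp only: ceiling_le_iff)
  with \<open>N > 0\<close> show ?thesis by (simp add: cell_def)
qed

lemma cell_bounds:
  assumes "N > 0" "u \<ge> 0"
  shows "u \<in> {real (cell N u) / real N .. real (cell N u + 1) / real N}"
proof -
  have "real N * u \<ge> 0" using assms by simp
  then have "real N * u \<le> real (cell N u + 1)" "real (cell N u) \<le> real N * u"
    unfolding cell_def by linarith+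
  then show ?thesis using assms by (simp add: field_simps)
qed

lemma measurable_cell: "cell N \<in> measurable borel (count_space UNIV)"
  unfolding cell_def[abs_def] by measurable

text \<open>Letters 0 and 1 of \<open>z\<close> depend on coordinates \<open>0..k - 2\<close> and
  \<open>1..k - 1\<close>, so the comparison stays within the \<open>k\<close> coordinates.\<close>

definition tower_factor :: "nat \<Rightarrow> (nat \<Rightarrow> real) \<Rightarrow> nat" where
  "tower_factor k v =
    (let z = (arcs ^^ (k - 2)) (\<lambda>j. cell (2 * half_letters k (k - 2)) (v j)) in of_bool (z 0 < z 1))"

lemma measurable_arcs_iterate:
  assumes "\<And>j. j \<in> {i..i + n} \<Longrightarrow> (\<lambda>v. w v j) \<in> measurable M (count_space UNIV)"
  shows "(\<lambda>v. (arcs ^^ n) (w v) i) \<in> measurable M (count_space UNIV)"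
  using assms
proof (induction n arbitrary: i)
  case (Suc n)
  have w [measurable]: "(\<lambda>v. (arcs ^^ n) (w v) i) \<in> measurable M (count_space UNIV)"
    "(\<lambda>v. (arcs ^^ n) (w v) (Suc i)) \<in> measurable M (count_space UNIV)"
    by (rule Suc.IH; use Suc.prems in auto)+
  show ?case by (simp add: arcs_def[of "(arcs ^^ n) _"])
qed simp

lemma measurable_tower_factor:
  assumes "k \<ge> 2"
  shows "tower_factor k \<in> measurable (\<Pi>\<^sub>M j\<in>{..<k}. unit_borel) (count_space {0, 1})"
proof -
  let ?N = "2 * half_letters k (k - 2)" and ?P = "\<Pi>\<^sub>M j\<in>{..<k}. unit_borel"
  have c: "(\<lambda>v. cell ?N (v j)) \<in> measurable ?P (count_space UNIV)" if "j < k" for j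
  proof -
    have "(\<lambda>v. v j) \<in> measurable ?P unit_borel"
      using that by (intro measurable_component_singleton) auto
    moreover have "cell ?N \<in> measurable unit_borel (count_space UNIV)"
      by (rule measurable_restrict_space1[OF measurable_cell])
    ultimately show ?thesis by (rule measurable_compose)
  qed
  have z: "(\<lambda>v. (arcs ^^ (k - 2)) (\<lambda>j. cell ?N (v j)) i) \<in> measurable ?P (count_space UNIV)"
    if "i < 2" for i
    using that assms by (intro measurable_arcs_iterate c) auto
  \<comment> \<open>Letter 1 is first frozen at \<open>b\<close>; having countably many values, it
    can then be substituted back.\<close>
  have "(\<lambda>v. of_bool ((arcs ^^ (k - 2)) (\<lambda>j. cell ?N (v j)) 0 < b) :: nat)
      \<in> measurable ?P (count_space UNIV)" for b
    by (rule measurable_compose[OF z[of 0]]) auto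
  from measurable_compose_countable[OF this z[of 1]]
  have "tower_factor k \<in> measurable ?P (count_space UNIV)"
    by (simp add: tower_factor_def[abs_def] Let_def)
  then show ?thesis
    by (rule measurable_count_space_extend[rotated 2]) (auto simp: tower_factor_def Let_def)
qed

text \<open>All blocks are read off one global word. As \<open>U\<close> starts at index 1 and words
  at 0, block \<open>i\<close> compares letters \<open>i - 1\<close> and \<open>i\<close>.\<close>

lemma tower_factor_block:
  assumes "k \<ge> 2" "i \<ge> 1"
  shows "block_factor k (tower_factor k) U i \<omega> =
    (let z = (arcs ^^ (k - 2)) (\<lambda>j. cell (2 * half_letters k (k - 2)) (U (Suc j) \<omega>))
     in of_bool (z (i - 1) < z i))"
proof -
  let ?N = "2 * half_letters k (k - 2)"
  have "(arcs ^^ (k - 2)) (\<lambda>j. cell ?N ((\<lambda>j\<in>{..<k}. U (i + j) \<omega>) j)) a =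
    (arcs ^^ (k - 2)) (\<lambda>j. cell ?N (U (Suc j) \<omega>)) (i - 1 + a)" if "a < 2" for a
    using that assms by (intro arcs_iterate_cong) (auto simp: add.assoc)
  from this[of 0] this[of 1] assms(2) show ?thesis
    unfolding block_factor_def tower_factor_def Let_def by simp
qed

lemma tower_factor_constant_imp_collision:
  assumes "k \<ge> 2"
    and U: "\<And>i. i \<ge> 1 \<Longrightarrow> U i \<omega> \<in> {0..1}"
    and const: "\<forall>i\<in>{1..2 * k}. block_factor k (tower_factor k) U i \<omega> = block_factor k (tower_factor k) U 1 \<omega>"
  defines "N \<equiv> 2 * half_letters k (k - 2)"
  shows "\<exists>i\<in>{1..3 * k - 2}. cell N (U i \<omega>) = cell N (U (Suc i) \<omega>)"
proof (rule ccontr)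
  assume *: "\<not> ?thesis"
  let ?w = "\<lambda>j. cell N (U (Suc j) \<omega>)"
  let ?z = "(arcs ^^ (k - 2)) ?w"
  have "N > 0" using half_letters_pos[of k "k - 2"] assms(1) by (simp add: N_def)
  \<comment> \<open>The \<open>3 * k - 2\<close> pairs are the \<open>2 * k\<close> final
    comparisons plus one pair lost in each of the \<open>k - 2\<close> iterations.\<close>
  then have "proper N (2 * k + (k - 2)) ?w"
    using * U assms(1) by (auto simp: proper_def intro!: cell_less)
  then have "proper (2 * k) (2 * k) ?z"
    using assms(1) by (intro proper_arcs_iterate) (auto simp: N_def)
  moreover have "\<forall>i<2 * k. (?z i < ?z (Suc i)) = (?z 0 < ?z 1)"
  proof (intro allI impI)
    fix i assume "i < 2 * k"
    then have "block_factor k (tower_factor k) U (Suc i) \<omega> = block_factor k (tower_factor k) U 1 \<omega>"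
      by (intro bspec[OF const]) simp
    then show "(?z i < ?z (Suc i)) = (?z 0 < ?z 1)"
      using assms(1) by (simp add: tower_factor_block Let_def N_def of_bool_eq_iff)
  qed
  ultimately show False using proper_not_monotone by blast
qed

section \<open>Collision probabilities and the final bound\<close>

lemma iid_uniform_range:
  assumes "iid_uniform M U" "i \<ge> 1" "\<omega> \<in> space M"
  shows "U i \<omega> \<in> {0..1}"
proof -
  interpret prob_space M using assms by (simp add: iid_uniform_def)
  have "random_variable unit_borel (U i)"
    using assms by (auto simp: iid_uniform_def indep_vars_def)
  from measurable_space[OF this assms(3)] show ?thesis by (simp add: space_restrict_space)
qed

lemma iid_uniform_cell:
  assumes iid: "iid_uniform M U" and "i \<ge> 1" "N > 0"
  shows "{\<omega> \<in> space M. cell N (U i \<omega>) = c} \<in> sets M"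
    and "measure M {\<omega> \<in> space M. cell N (U i \<omega>) = c} \<le> 1 / N"
proof -
  interpret prob_space M using iid by (simp add: iid_uniform_def)
  have rv: "random_variable unit_borel (U i)"
    using iid \<open>i \<ge> 1\<close> by (auto simp: iid_uniform_def indep_vars_def)
  then have [measurable]: "U i \<in> borel_measurable M" and sp: "U i \<in> space M \<rightarrow> {0..1}"
    by (auto simp: measurable_restrict_space2_iff)
  note measurable_cell[measurable]
  show "{\<omega> \<in> space M. cell N (U i \<omega>) = c} \<in> sets M" by measurable
  let ?I = "{real c / N .. real (c + 1) / N}"
  have "prob {\<omega> \<in> space M. cell N (U i \<omega>) = c} \<le> prob (U i -` ?I \<inter> space M)"
    using sp cell_bounds[OF \<open>N > 0\<close>] by (intro finite_measure_mono) fastforce+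
  also have "\<dots> = measure (uniform_measure lborel {0..1}) ?I"
    using iid \<open>i \<ge> 1\<close> measure_distr[of "U i" M lborel ?I] by (auto simp: iid_uniform_def)
  also have "\<dots> = measure lborel ({0..1} \<inter> ?I)"
    by (simp add: measure_def emeasure_uniform_measure divide_ennreal_def)
  also have "\<dots> \<le> measure lborel ?I"
    by (intro measure_mono_fmeasurable) (auto intro!: fmeasurableI simp: emeasure_lborel_Icc_eq)
  also have "\<dots> = 1 / N" using \<open>N > 0\<close> by (simp add: field_simps)
  finally show "prob {\<omega> \<in> space M. cell N (U i \<omega>) = c} \<le> 1 / N" .
qed

text \<open>A collision happens in one of \<open>N\<close> common cells; by independence each
  contributes at most the square of \<open>1 / N\<close>.\<close>

lemma iid_uniform_collision:
  assumes iid: "iid_uniform M U" and "i \<ge> 1" "j \<ge> 1" "i \<noteq> j" "N > 0"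
  shows "{\<omega> \<in> space M. cell N (U i \<omega>) = cell N (U j \<omega>)} \<in> sets M"
    and "measure M {\<omega> \<in> space M. cell N (U i \<omega>) = cell N (U j \<omega>)} \<le> 1 / N"
proof -
  interpret prob_space M using iid by (simp add: iid_uniform_def)
  have ind: "indep_vars (\<lambda>_. unit_borel) U {1..}" using iid by (simp add: iid_uniform_def)
  have sp: "U l \<omega> \<in> {0..1}" if "\<omega> \<in> space M" "l \<ge> 1" for l \<omega>
    using iid_uniform_range[OF iid] that by blast
  let ?E = "\<lambda>l c. {\<omega> \<in> space M. cell N (U l \<omega>) = c}"
  note E = iid_uniform_cell[OF iid _ \<open>N > 0\<close>]
  have eq: "{\<omega> \<in> space M. cell N (U i \<omega>) = cell N (U j \<omega>)} = (\<Union>c<N. ?E i c \<inter> ?E j c)"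
    using sp cell_less[OF \<open>N > 0\<close>] assms(2,3) by auto
  show "{\<omega> \<in> space M. cell N (U i \<omega>) = cell N (U j \<omega>)} \<in> sets M"
    unfolding eq using E(1) assms(2,3) by auto
  have pair: "prob (?E i c \<inter> ?E j c) = prob (?E i c) * prob (?E j c)" for c
  proof -
    let ?A = "cell N -` {c} \<inter> {0..1}"
    have A: "?A \<in> sets unit_borel"
      using measurable_sets[OF measurable_restrict_space1[OF measurable_cell[of N]], of "{c}" "{0..1}"]
      by (simp add: space_restrict_space)
    have "prob (\<Inter>l\<in>{i, j}. U l -` ?A \<inter> space M) = (\<Prod>l\<in>{i, j}. prob (U l -` ?A \<inter> space M))"
      using A assms by (intro indep_varsD[OF ind]) auto
    moreover have "U l -` ?A \<inter> space M = ?E l c" if "l \<ge> 1" for l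
      using sp that by auto
    ultimately show ?thesis using assms by simp
  qed
  have "prob (\<Union>c<N. ?E i c \<inter> ?E j c) \<le> (\<Sum>c<N. prob (?E i c \<inter> ?E j c))"
    using E(1) assms(2,3) by (intro finite_measure_subadditive_finite) auto
  also have "\<dots> \<le> (\<Sum>c<N. 1 / N * (1 / N))"
    unfolding pair using E(2) assms(2,3) by (intro sum_mono mult_mono) auto
  also have "\<dots> = 1 / N" using \<open>N > 0\<close> by simp
  finally show "prob {\<omega> \<in> space M. cell N (U i \<omega>) = cell N (U j \<omega>)} \<le> 1 / N"
    unfolding eq .
qed

lemma tower_factor_constant_prob:
  assumes iid: "iid_uniform M U" and "k \<ge> 2"
  shows "measure M {\<omega> \<in> space M. \<forall>i\<in>{1..2 * k}.
      block_factor k (tower_factor k) U i \<omega> = block_factor k (tower_factor k) U 1 \<omega>}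
    \<le> 3 * real k / (2 * half_letters k (k - 2))"
proof -
  interpret prob_space M using iid by (simp add: iid_uniform_def)
  let ?N = "2 * half_letters k (k - 2)"
  let ?C = "\<lambda>i. {\<omega> \<in> space M. cell ?N (U i \<omega>) = cell ?N (U (Suc i) \<omega>)}"
  have N: "?N > 0" using half_letters_pos[of k "k - 2"] assms(2) by simp
  have sp: "U l \<omega> \<in> {0..1}" if "\<omega> \<in> space M" "l \<ge> 1" for l \<omega>
    using iid_uniform_range[OF iid] that by blast
  have C: "?C i \<in> sets M" "prob (?C i) \<le> 1 / ?N" if "i \<ge> 1" for i
    using iid_uniform_collision[OF iid that _ _ N, of "Suc i"] by auto
  have "prob {\<omega> \<in> space M. \<forall>i\<in>{1..2 * k}.
      block_factor k (tower_factor k) U i \<omega> = block_factor k (tower_factor k) U 1 \<omega>}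
    \<le> prob (\<Union>i\<in>{1..3 * k - 2}. ?C i)"
  proof (rule finite_measure_mono)
    show "(\<Union>i\<in>{1..3 * k - 2}. ?C i) \<in> events" using C(1) by auto
  next
    have "\<exists>i\<in>{1..3 * k - 2}. cell ?N (U i \<omega>) = cell ?N (U (Suc i) \<omega>)"
      if "\<omega> \<in> space M" "\<forall>i\<in>{1..2 * k}.
        block_factor k (tower_factor k) U i \<omega> = block_factor k (tower_factor k) U 1 \<omega>" for \<omega>
      by (rule tower_factor_constant_imp_collision[OF assms(2) sp[OF that(1)] that(2)])
    then show "{\<omega> \<in> space M. \<forall>i\<in>{1..2 * k}.
        block_factor k (tower_factor k) U i \<omega> = block_factor k (tower_factor k) U 1 \<omega>}
      \<subseteq> (\<Union>i\<in>{1..3 * k - 2}. ?C i)"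
      by blast
  qed
  also have "\<dots> \<le> (\<Sum>i\<in>{1..3 * k - 2}. prob (?C i))"
    using C(1) by (intro finite_measure_subadditive_finite) auto
  also have "\<dots> \<le> (\<Sum>i\<in>{1..3 * k - 2}. 1 / ?N)"
    using C(2) by (intro sum_mono) auto
  also have "\<dots> \<le> 3 * real k / ?N"
    by (simp add: divide_right_mono)
  finally show ?thesis by simp
qed

theorem theorem3:
  "\<forall>\<^sub>F k in sequentially.
     \<exists>f \<in> measurable (\<Pi>\<^sub>M j\<in>{..<k}. unit_borel) (count_space {0, 1 :: nat}).
       \<forall>(M :: 'a measure) U. iid_uniform M U \<longrightarrow>
         measure M {\<omega> \<in> space M. \<forall>i\<in>{1..2 * k}. block_factor k f U i \<omega> = block_factor k f U 1 \<omega>}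
           < 9 * (real k)\<^sup>2 / tower (k - 2) (real k / sqrt 8)"
proof (rule eventually_sequentiallyI[of 6], intro bexI allI impI)
  fix k :: nat and M :: "'a measure" and U
  assume k: "6 \<le> k" and iid: "iid_uniform M U"
  let ?x = "real k / sqrt 8" and ?h = "half_letters k (k - 2)"
  have s: "2 \<le> sqrt 8" "sqrt 8 \<le> 3" by (auto intro: real_le_rsqrt real_le_lsqrt)
  \<comment> \<open>With these bounds \<open>k \<ge> 6\<close> gives \<open>k / 3 \<ge> 2\<close>
    and \<open>k - k / 2 \<ge> 2\<close>.\<close>
  have "real k / 3 \<le> ?x" "?x \<le> real k / 2"
    by (rule divide_left_mono; use s in simp)+
  then have x: "?x \<ge> 2" "real k \<ge> ?x + 2" using k by linarith+
  have T: "tower (k - 2) ?x > 0" "tower (k - 2) ?x < 2 * ?h"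
    using tower_ge[OF x(1), of "k - 2"] half_letters_ge_tower[OF x, of "k - 2"] by auto
  \<comment> \<open>Strictness comes from the denominators.\<close>
  have "3 * real k / (2 * ?h) < 9 * (real k)\<^sup>2 / tower (k - 2) ?x"
    using T k by (intro frac_less2) (auto simp: power2_eq_square)
  then show "measure M {\<omega> \<in> space M. \<forall>i\<in>{1..2 * k}.
      block_factor k (tower_factor k) U i \<omega> = block_factor k (tower_factor k) U 1 \<omega>}
    < 9 * (real k)\<^sup>2 / tower (k - 2) ?x"
    using tower_factor_constant_prob[OF iid, of k] k by linarith
qed (use measurable_tower_factor in auto)

end
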